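(* Let $N\ge 2$, $m\ge 1$, $U,U_r\in\mathbb R_+$, and let $y^{(1)},\dots,y^{(m)}\in\mathbb R^{N-1}\setminus\{0\}$. Let $$P=\{(x,s)\in\mathbb R^{N-1}\times\mathbb R_+ : |x_j|\le U\ (j=1,\dots,N-1),\ s\le U_r,\ (y^{(i)}/\|y^{(i)}\|_2)^\top x\le s\ (i=1,\dots,m)\}.$$ For $y^{(m+1)}\in\mathbb R^{N-1}\setminus\{0\}$ let $\bar P=P\cap\{(x,s):(y^{(m+1)}/\|y^{(m+1)}\|_2)^\top x\le s\}$, let $\theta_i\in[0,\pi]$ be the angle between $y^{(m+1)}$ and $y^{(i)}$ for $i=1,\dots,m$, and let $\bar\theta=\min_{i=1,\dots,m}\theta_i$. Then $$\mathrm{Vol}(P)-\mathrm{Vol}(\bar P)=O(\bar\theta),$$ i.e. there is a constant $C<\infty$, depending only on $N,U,U_r,y^{(1)},\dots,y^{(m)}$ and not on $y^{(m+1)}$, such that $\mathrm{Vol}(P)-\mathrm{Vol}(\bar P)\le C\,\bar\theta$ for every $y^{(m+1)}\in\mathbb R^{N-1}\setminus\{0\}$.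
   Context: $\mathrm{Vol}$ denotes $N$-dimensional Lebesgue measure. The sets $P,\bar P$ are polyhedral outer approximations, within the bounding box, of the second-order cone $\{(x,s)\in\mathbb R^{N-1}\times\mathbb R_+:\|x\|_2\le s\}$. *)

theory Defs
  imports "HOL-Analysis.Analysis"
begin

(* A pair (x, s) of type (real ^ 'n) * real is a point of R^(N-1) x R with CARD('n) = N - 1,
   so N >= 2 holds because types are nonempty. *)

definition angle :: "'a::real_inner \<Rightarrow> 'a \<Rightarrow> real" where
  "angle u v = arccos ((u \<bullet> v) / (norm u * norm v))"

definition soc_halfspace :: "real ^ 'n \<Rightarrow> ((real ^ 'n) \<times> real) set" where
  "soc_halfspace v = {(x, s). (v /\<^sub>R norm v) \<bullet> x \<le> s}"

definition outer_polyhedron ::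
  "real \<Rightarrow> real \<Rightarrow> nat \<Rightarrow> (nat \<Rightarrow> real ^ 'n) \<Rightarrow> ((real ^ 'n) \<times> real) set" where
  "outer_polyhedron U U\<^sub>r m y =
     {(x, s). 0 \<le> s \<and> (\<forall>j. \<bar>x $ j\<bar> \<le> U) \<and> s \<le> U\<^sub>r \<and> (\<forall>i\<in>{1..m}. (x, s) \<in> soc_halfspace (y i))}"

end

theory Submission
  imports Defs
begin

text \<open>
  The points that the new cut removes form a thin layer. Let \<open>u\<close> be the unit vector of
  \<open>y'\<close> and \<open>v\<close> that of the \<open>y i\<close> closest to it in angle, at angle \<open>\<theta>\<close>. A removed point
  \<open>(x, s)\<close> satisfies the old inequality \<open>v \<bullet> x \<le> s\<close> but violates the new one, so
  \<open>v \<bullet> x \<le> s < u \<bullet> x\<close>. The chord joining two points of the unit sphere is at most as long as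
  the arc (\<open>norm_diff_unit_le_angle\<close>), so by Cauchy-Schwarz
  \<open>u \<bullet> x \<le> v \<bullet> x + \<theta> * R\<close>, where \<open>R\<close> bounds the norm on the bounding box \<open>B\<close> of \<open>x\<close>.
  Hence the removed set lies in a layer over \<open>B\<close> of constant height \<open>\<theta> * R\<close>, whose volume is
  \<open>\<theta> * R\<close> times that of \<open>B\<close> whatever the slope \<open>v\<close> is (\<open>emeasure_layer_over\<close>). Neither
  \<open>R\<close> nor the volume of \<open>B\<close> depends on \<open>y'\<close>.
\<close>

lemma abs_cosine_le_one:
  fixes u v :: "'a::real_inner"
  shows "\<bar>(u \<bullet> v) / (norm u * norm v)\<bar> \<le> 1"
  using Cauchy_Schwarz_ineq2[of u v] by (simp add: divide_le_eq)

lemma cos_angle: "cos (angle u v) = (u \<bullet> v) / (norm u * norm v)"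
  unfolding angle_def by (rule cos_arccos_abs[OF abs_cosine_le_one])

lemma angle_nonneg: "0 \<le> angle u v"
  using abs_cosine_le_one[of u v] unfolding angle_def by (intro arccos_lbound) linarith+

text \<open>
  The chord of an arc of length \<open>\<theta>\<close> on the unit sphere has length \<open>2 * sin (\<theta> / 2)\<close>, and
  \<open>sin t \<le> t\<close> for \<open>t \<ge> 0\<close>.
\<close>

lemma norm_diff_unit_le_angle:
  assumes "u \<noteq> 0" "v \<noteq> 0"
  shows "norm (u /\<^sub>R norm u - v /\<^sub>R norm v) \<le> angle u v"
proof -
  let ?\<theta> = "angle u v"
  have nonneg: "0 \<le> ?\<theta>"
    by (rule angle_nonneg)
  have "(norm (u /\<^sub>R norm u - v /\<^sub>R norm v))\<^sup>2
      = 1 + 1 - 2 * ((u /\<^sub>R norm u) \<bullet> (v /\<^sub>R norm v))"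
    using assms dot_norm_neg[of "u /\<^sub>R norm u" "v /\<^sub>R norm v"] by (simp add: field_simps)
  also have "\<dots> = 2 - 2 * cos ?\<theta>"
    by (simp add: cos_angle field_simps)
  also have "\<dots> = (2 * sin (?\<theta> / 2))\<^sup>2"
    using cos_double_sin[of "?\<theta> / 2"] by (simp add: power2_eq_square)
  also have "\<dots> \<le> ?\<theta>\<^sup>2"
    using abs_sin_x_le_abs_x[of "?\<theta> / 2"] by (intro power2_le_iff_abs_le[THEN iffD2] nonneg)
      (use nonneg in \<open>simp add: abs_mult\<close>)
  finally show ?thesis
    using nonneg by (rule power2_le_imp_le)
qed

lemma sets_layer_over:
  fixes f :: "'a::euclidean_space \<Rightarrow> real"
  assumes [measurable]: "f \<in> borel_measurable borel" "B \<in> sets borel"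
  shows "{(x, s). x \<in> B \<and> f x \<le> s \<and> s \<le> f x + h} \<in> sets borel"
proof -
  have "{(x, s). x \<in> B \<and> f x \<le> s \<and> s \<le> f x + h} =
      {z \<in> space (borel \<Otimes>\<^sub>M borel). fst z \<in> B \<and> f (fst z) \<le> snd z \<and> snd z \<le> f (fst z) + h}"
    by (auto simp: space_pair_measure)
  also have "\<dots> \<in> sets (borel \<Otimes>\<^sub>M borel)"
    by measurable
  finally show ?thesis
    unfolding borel_prod .
qed

text \<open>
  By Fubini, since every vertical section of the layer is an interval of the same length \<open>h\<close>.
\<close>

lemma emeasure_layer_over:
  fixes f :: "'a::euclidean_space \<Rightarrow> real"
  assumes f: "f \<in> borel_measurable borel" and B: "B \<in> sets borel" and "0 \<le> h"
  shows "emeasure lborel {(x, s). x \<in> B \<and> f x \<le> s \<and> s \<le> f x + h} = ennreal h * emeasure lborel B"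
proof -
  let ?L = "{(x, s). x \<in> B \<and> f x \<le> s \<and> s \<le> f x + h}"
  have vertical_section: "emeasure lborel (Pair x -` ?L) = ennreal h * indicator B x" for x
  proof (cases "x \<in> B")
    case True
    then have "Pair x -` ?L = {f x..f x + h}" by auto
    then show ?thesis using True \<open>0 \<le> h\<close> by simp
  qed simp
  have "emeasure lborel ?L = emeasure (lborel \<Otimes>\<^sub>M lborel) ?L"
    by (simp add: lborel_prod)
  also have "\<dots> = (\<integral>\<^sup>+ x. emeasure lborel (Pair x -` ?L) \<partial>lborel)"
    by (rule lborel.emeasure_pair_measure_alt) (simp only: lborel_prod sets_lborel sets_layer_over[OF f B])
  also have "\<dots> = ennreal h * emeasure lborel B"
    unfolding vertical_section by (rule nn_integral_cmult_indicator) (simp add: B)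
  finally show ?thesis .
qed

lemma closed_soc_halfspace: "closed (soc_halfspace v)"
  unfolding soc_halfspace_def case_prod_beta by (intro closed_Collect_le continuous_intros)

lemma outer_polyhedron_subset_cbox:
  "outer_polyhedron U U\<^sub>r m y \<subseteq> cbox (\<chi> i. - U, 0) (\<chi> i. U, U\<^sub>r)"
proof
  fix z
  assume z: "z \<in> outer_polyhedron U U\<^sub>r m y"
  obtain x s where "z = (x, s)" by (cases z)
  with z show "z \<in> cbox (\<chi> i. - U, 0) (\<chi> i. U, U\<^sub>r)"
    by (auto simp: outer_polyhedron_def cbox_Pair_eq mem_box_cart abs_le_iff minus_le_iff)
qed

lemma closed_outer_polyhedron: "closed (outer_polyhedron U U\<^sub>r m y)"
proof -
  have "outer_polyhedron U U\<^sub>r m y =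
      {z. 0 \<le> snd z} \<inter> (\<Inter>j. {z. \<bar>fst z $ j\<bar> \<le> U}) \<inter> {z. snd z \<le> U\<^sub>r}
      \<inter> (\<Inter>i\<in>{1..m}. soc_halfspace (y i))"
    by (auto simp: outer_polyhedron_def)
  moreover have "closed \<dots>"
    by (intro closed_Int closed_INT ballI closed_Collect_le continuous_intros closed_soc_halfspace)
  ultimately show ?thesis by simp
qed

lemma outer_polyhedron_lmeasurable: "outer_polyhedron U U\<^sub>r m y \<in> lmeasurable"
proof -
  have "bounded (outer_polyhedron U U\<^sub>r m y)"
    by (rule bounded_subset[OF bounded_cbox outer_polyhedron_subset_cbox])
  then have "compact (outer_polyhedron U U\<^sub>r m y)"
    unfolding compact_eq_bounded_closed using closed_outer_polyhedron by blast
  then show ?thesis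
    by (rule lmeasurable_compact)
qed

theorem theorem2p4:
  fixes U U\<^sub>r :: real and m :: nat and y :: "nat \<Rightarrow> real ^ 'n"
  assumes "1 \<le> m" and "0 \<le> U" and "0 \<le> U\<^sub>r"
    and "\<And>i. i \<in> {1..m} \<Longrightarrow> y i \<noteq> 0"
  shows "\<exists>C::real. \<forall>y'::real ^ 'n. y' \<noteq> 0 \<longrightarrow>
    measure lebesgue (outer_polyhedron U U\<^sub>r m y)
      - measure lebesgue (outer_polyhedron U U\<^sub>r m y \<inter> soc_halfspace y')
    \<le> C * Min ((\<lambda>i. angle y' (y i)) ` {1..m})"
proof -
  define P where "P = outer_polyhedron U U\<^sub>r m y"
  define B :: "(real ^ 'n) set" where "B = cbox (\<chi> i. - U) (\<chi> i. U)"
  have "bounded B"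
    unfolding B_def by (rule bounded_cbox)
  obtain R where R: "0 < R" "\<And>x. x \<in> B \<Longrightarrow> norm x \<le> R"
    using \<open>bounded B\<close> unfolding bounded_pos by blast
  have "measure lebesgue P - measure lebesgue (P \<inter> soc_halfspace y')
      \<le> R * measure lborel B * Min ((\<lambda>i. angle y' (y i)) ` {1..m})"
    if "y' \<noteq> 0" for y'
  proof -
    have "Min ((\<lambda>i. angle y' (y i)) ` {1..m}) \<in> (\<lambda>i. angle y' (y i)) ` {1..m}"
      using \<open>1 \<le> m\<close> by (intro Min_in) auto
    then obtain i where i: "i \<in> {1..m}"
      and nearest: "Min ((\<lambda>i. angle y' (y i)) ` {1..m}) = angle y' (y i)"
      by auto
    define u where "u = y' /\<^sub>R norm y'"
    define v where "v = y i /\<^sub>R norm (y i)"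
    define \<theta> where "\<theta> = angle y' (y i)"
    define L where "L = {(x, s). x \<in> B \<and> v \<bullet> x \<le> s \<and> s \<le> v \<bullet> x + \<theta> * R}"
    have chord: "norm (u - v) \<le> \<theta>"
      unfolding u_def v_def \<theta>_def using that assms(4)[OF i] by (rule norm_diff_unit_le_angle)
    have height: "0 \<le> \<theta> * R"
      using order_trans[OF norm_ge_zero chord] R(1) by simp
    have L_borel: "L \<in> sets borel"
      unfolding L_def by (rule sets_layer_over) (simp_all add: B_def)
    have L_emeasure: "emeasure lborel L = ennreal (\<theta> * R) * emeasure lborel B"
      unfolding L_def by (rule emeasure_layer_over) (use height in \<open>simp_all add: B_def\<close>)
    have B_finite: "emeasure lborel B = ennreal (measure lborel B)"
      unfolding B_def
      by (metis emeasure_eq_ennreal_measure emeasure_lborel_cbox_finite infinity_ennreal_def less_irrefl)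
    have L_finite: "emeasure lborel L = ennreal (\<theta> * R * measure lborel B)"
      unfolding L_emeasure B_finite using height by (simp add: ennreal_mult)
    have L_lmeasurable: "L \<in> lmeasurable"
      using L_borel L_finite by (intro fmeasurableI) simp_all
    have L_measure: "measure lebesgue L = \<theta> * R * measure lborel B"
      using L_borel L_finite height by (simp add: measure_def)
    have P_lmeasurable: "P \<in> lmeasurable"
      unfolding P_def by (rule outer_polyhedron_lmeasurable)
    have cut_lmeasurable: "P \<inter> soc_halfspace y' \<in> lmeasurable"
      using P_lmeasurable closed_soc_halfspace[of y']
      by (intro fmeasurable_Int_fmeasurable) simp_all
    have removed_subset: "P - P \<inter> soc_halfspace y' \<subseteq> L"
    proof
      fix z
      assume z: "z \<in> P - P \<inter> soc_halfspace y'"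
      obtain x s where z_eq: "z = (x, s)" by (cases z)
      have "x \<in> B"
        using z z_eq outer_polyhedron_subset_cbox[of U U\<^sub>r m y]
        by (auto simp: P_def B_def cbox_Pair_eq)
      have old: "v \<bullet> x \<le> s" and new: "s < u \<bullet> x"
        using z z_eq i by (auto simp: P_def outer_polyhedron_def soc_halfspace_def u_def v_def)
      have "(u - v) \<bullet> x \<le> norm (u - v) * norm x"
        by (rule norm_cauchy_schwarz)
      also have "\<dots> \<le> \<theta> * R"
        using chord R(2)[OF \<open>x \<in> B\<close>] order_trans[OF norm_ge_zero chord]
        by (intro mult_mono) simp_all
      finally have "u \<bullet> x \<le> v \<bullet> x + \<theta> * R"
        by (simp add: inner_diff_left)
      then show "z \<in> L"
        using \<open>x \<in> B\<close> old new z_eq by (simp add: L_def)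
    qed
    have "measure lebesgue P - measure lebesgue (P \<inter> soc_halfspace y')
        = measure lebesgue (P - P \<inter> soc_halfspace y')"
      using P_lmeasurable cut_lmeasurable by (intro measurable_measure_Diff[symmetric]) auto
    also have "\<dots> \<le> measure lebesgue L"
      using removed_subset P_lmeasurable cut_lmeasurable L_lmeasurable
      by (intro measure_mono_fmeasurable) auto
    also have "\<dots> = R * measure lborel B * \<theta>"
      unfolding L_measure by simp
    finally show ?thesis
      unfolding nearest \<theta>_def .
  qed
  then show ?thesis
    unfolding P_def by blast
qed

end
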